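(* The implicit difference scheme (written out in the context) of the one-dimensional time-space Caputo-Riesz fractional diffusion equation ${}_0^C D_t^{\gamma}u(x,t)=c(x,t)\frac{\partial^{\alpha}u(x,t)}{\partial|x|^{\alpha}}+f(x,t)$, $c\ge 0$, with $0<\gamma\le 1$, $1<\alpha\le 2$, is unconditionally stable.
   Context: "Stable" is meant in the usual sense for difference schemes (bounded propagation of the perturbation $\widetilde u_i^k-u_i^k$ between an approximate solution $\widetilde u_i^k$ and the exact solution $u_i^k$ of the scheme); "unconditionally" means without any restriction on the step sizes $\tau,\Delta x$. Derivatives: ${}_0^C D_t^\gamma u=\frac1{\Gamma(1-\gamma)}\int_0^t\partial_\eta u(x,\eta)(t-\eta)^{-\gamma}d\eta$ for $0<\gamma<1$ and $\partial_t u$ for $\gamma=1$ (Caputo). Riesz derivative on $[x_L,x_R]$: $\frac{\partial^\alpha u}{\partial|x|^\alpha}=-\kappa_\alpha({}_{x_L}D_x^\alpha+{}_xD_{x_R}^\alpha)u$, $\kappa_\alpha=\frac1{2\cos(\alpha\pi/2)}$, with ${}_{x_L}D_x^\alpha u=\frac1{\Gamma(2-\alpha)}\partial_x^2\int_{x_L}^x(x-\xi)^{1-\alpha}u(\xi,t)d\xi$ and ${}_xD_{x_R}^\alpha u=\frac1{\Gamma(2-\alpha)}\partial_x^2\int_x^{x_R}(\xi-x)^{1-\alpha}u(\xi,t)d\xi$ for $1<\alpha<2$, both equal to $\partial_x^2u$ for $\alpha=2$. Mesh: $x_i=x_L+i\Delta x$ $(i=0,\dots,N_x)$, $\Delta x=(x_R-x_L)/N_x$;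 $t_k=k\tau$ $(k=0,\dots,N_t)$, $\tau=T/N_t$. Time coefficients: $l_s=(s+1)^{1-\gamma}-s^{1-\gamma}$ for $0<\gamma<1$; for $\gamma=1$, $l_0=1$ and $l_s=0$ for $s>0$. Space coefficients: $g_{i,m}^{\nu}=p_{i,m}^{\nu}+q_{i,m}^{\nu}$ (used with $\nu=\alpha$, $N=N_x$), where $p_{i,m}^{\nu}=a_{i-1,m}-2a_{i,m}+a_{i+1,m}$ for $m\le i-1$, $p_{i,i}^{\nu}=-2a_{i,i}+a_{i+1,i}$, $p_{i,i+1}^{\nu}=a_{i+1,i+1}$, $p_{i,m}^{\nu}=0$ for $m>i+1$; $q_{i,m}^{\nu}=0$ for $m<i-1$, $q_{i,i-1}^{\nu}=b_{i-1,i-1}$, $q_{i,i}^{\nu}=-2b_{i,i}+b_{i-1,i}$, $q_{i,m}^{\nu}=b_{i-1,m}-2b_{i,m}+b_{i+1,m}$ for $i+1\le m\le N$; and, for $j=i-1,i,i+1$: $a_{j,m}=1$ for $m=j$; otherwise $a_{j,0}=(j-1)^{3-\nu}-j^{2-\nu}(j-3+\nu)$ and $a_{j,m}=(j-m+1)^{3-\nu}-2(j-m)^{3-\nu}+(j-m-1)^{3-\nu}$ for $1\le m\le j-1$; $b_{j,m}=1$ for $m=j$; otherwise $b_{j,m}=(m-j+1)^{3-\nu}-2(m-j)^{3-\nu}+(m-j-1)^{3-\nu}$ for $j+1\le m\le N-1$ and $b_{j,N}=(3-\nu-N+j)(N-j)^{2-\nu}+(N-j-1)^{3-\nu}$. Further,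 $c_i^k=c(x_i,t_k)$, $f_i^k=f(x_i,t_k)$, $\mu=\Gamma(2-\gamma)\tau^\gamma$, $\omega_{i,k+1}=-\frac{\Gamma(2-\gamma)\tau^{\gamma}\kappa_\alpha c_i^{k+1}}{\Gamma(4-\alpha)(\Delta x)^\alpha}$. Implicit scheme ($i=0,1,\dots,N_x$): $$(1-\omega_{i,1}g_{i,i}^{\alpha})u_i^{1}-\omega_{i,1}\sum_{m=0,m\ne i}^{N_x}g_{i,m}^\alpha u_m^{1}=u_i^0+\mu f_i^1\quad(k=0),$$ $$(1-\omega_{i,k+1}g_{i,i}^{\alpha})u_i^{k+1}-\omega_{i,k+1}\sum_{m=0,m\ne i}^{N_x}g_{i,m}^\alpha u_m^{k+1}=\sum_{s=0}^{k-1}(l_s-l_{s+1})u_i^{k-s}+l_ku_i^0+\mu f_i^{k+1}\quad(k>0).$$ *)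

theory Defs
  imports "HOL-Analysis.Analysis"
begin

definition kappa :: "real \<Rightarrow> real" where
  "kappa \<alpha> = 1 / (2 * cos (\<alpha> * pi / 2))"

definition step :: "real \<Rightarrow> nat \<Rightarrow> real" where
  "step L n = L / real n"

definition l_coeff :: "real \<Rightarrow> nat \<Rightarrow> real" where
  "l_coeff \<gamma> s =
     (if \<gamma> = 1 then (if s = 0 then 1 else 0)
      else real (s + 1) powr (1 - \<gamma>) - real s powr (1 - \<gamma>))"

text \<open>The indices of the space coefficients are integers, because row \<open>i = 0\<close> refers to
  \<open>b (-1) m\<close>. Outside the ranges in which \<open>a\<close> and \<open>b\<close> are specified
  (\<open>0 \<le> m \<le> j\<close> and \<open>j \<le> m \<le> N\<close>, respectively) they are set to 0; the rows
  \<open>0 \<le> i \<le> N\<close> of \<open>g\<close> never use these values for \<open>0 \<le> m \<le> N\<close>.\<close>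

definition a_coeff :: "real \<Rightarrow> int \<Rightarrow> int \<Rightarrow> real" where
  "a_coeff \<nu> j m =
     (if m = j then 1
      else if m = 0 \<and> 1 \<le> j then
        real_of_int (j - 1) powr (3 - \<nu>)
          - real_of_int j powr (2 - \<nu>) * (real_of_int j - 3 + \<nu>)
      else if 1 \<le> m \<and> m \<le> j - 1 then
        real_of_int (j - m + 1) powr (3 - \<nu>) - 2 * real_of_int (j - m) powr (3 - \<nu>)
          + real_of_int (j - m - 1) powr (3 - \<nu>)
      else 0)"

definition b_coeff :: "real \<Rightarrow> int \<Rightarrow> int \<Rightarrow> int \<Rightarrow> real" where
  "b_coeff \<nu> N j m =
     (if m = j then 1
      else if j + 1 \<le> m \<and> m \<le> N - 1 then
        real_of_int (m - j + 1) powr (3 - \<nu>) - 2 * real_of_int (m - j) powr (3 - \<nu>)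
          + real_of_int (m - j - 1) powr (3 - \<nu>)
      else if m = N \<and> j + 1 \<le> N then
        (3 - \<nu> - real_of_int N + real_of_int j) * real_of_int (N - j) powr (2 - \<nu>)
          + real_of_int (N - j - 1) powr (3 - \<nu>)
      else 0)"

definition p_coeff :: "real \<Rightarrow> int \<Rightarrow> int \<Rightarrow> real" where
  "p_coeff \<nu> i m =
     (if m \<le> i - 1 then a_coeff \<nu> (i - 1) m - 2 * a_coeff \<nu> i m + a_coeff \<nu> (i + 1) m
      else if m = i then - 2 * a_coeff \<nu> i i + a_coeff \<nu> (i + 1) i
      else if m = i + 1 then a_coeff \<nu> (i + 1) (i + 1)
      else 0)"

definition q_coeff :: "real \<Rightarrow> int \<Rightarrow> int \<Rightarrow> int \<Rightarrow> real" where
  "q_coeff \<nu> N i m =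
     (if m < i - 1 then 0
      else if m = i - 1 then b_coeff \<nu> N (i - 1) (i - 1)
      else if m = i then - 2 * b_coeff \<nu> N i i + b_coeff \<nu> N (i - 1) i
      else b_coeff \<nu> N (i - 1) m - 2 * b_coeff \<nu> N i m + b_coeff \<nu> N (i + 1) m)"

definition g_coeff :: "real \<Rightarrow> nat \<Rightarrow> nat \<Rightarrow> nat \<Rightarrow> real" where
  "g_coeff \<nu> N i m =
     p_coeff \<nu> (int i) (int m) + q_coeff \<nu> (int N) (int i) (int m)"

text \<open>Coefficient functions \<open>c\<close>, \<open>f\<close> take their arguments in the order \<open>x\<close>, \<open>t\<close>;
  \<open>dx\<close> and \<open>\<tau>\<close> are the step sizes in space and time, and \<open>u i k\<close> is the value at
  \<open>(x\<^sub>i, t\<^sub>k)\<close>.\<close>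

definition on_mesh ::
    "real \<Rightarrow> real \<Rightarrow> real \<Rightarrow> (real \<Rightarrow> real \<Rightarrow> real) \<Rightarrow> nat \<Rightarrow> nat \<Rightarrow> real" where
  "on_mesh xL dx \<tau> h i k = h (xL + real i * dx) (real k * \<tau>)"

definition omega ::
    "real \<Rightarrow> real \<Rightarrow> real \<Rightarrow> real \<Rightarrow> real \<Rightarrow> (real \<Rightarrow> real \<Rightarrow> real) \<Rightarrow> nat \<Rightarrow> nat \<Rightarrow> real" where
  "omega \<gamma> \<alpha> xL dx \<tau> c i k =
     - (Gamma (2 - \<gamma>) * \<tau> powr \<gamma> * kappa \<alpha> * on_mesh xL dx \<tau> c i k)
       / (Gamma (4 - \<alpha>) * dx powr \<alpha>)"

definition solves_implicit_scheme ::
    "real \<Rightarrow> real \<Rightarrow> real \<Rightarrow> real \<Rightarrow> real \<Rightarrow> (real \<Rightarrow> real \<Rightarrow> real) \<Rightarrow> (real \<Rightarrow> real \<Rightarrow> real)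
       \<Rightarrow> nat \<Rightarrow> nat \<Rightarrow> (nat \<Rightarrow> nat \<Rightarrow> real) \<Rightarrow> bool" where
  "solves_implicit_scheme \<gamma> \<alpha> xL xR T c f Nx Nt u \<longleftrightarrow>
     (let dx = step (xR - xL) Nx;
          \<tau> = step T Nt;
          \<mu> = Gamma (2 - \<gamma>) * \<tau> powr \<gamma>;
          \<omega> = omega \<gamma> \<alpha> xL dx \<tau> c
      in \<forall>i\<le>Nx. \<forall>k<Nt.
           (1 - \<omega> i (k + 1) * g_coeff \<alpha> Nx i i) * u i (k + 1)
             - \<omega> i (k + 1) * (\<Sum>m\<in>{0..Nx} - {i}. g_coeff \<alpha> Nx i m * u m (k + 1))
           = (if k = 0 then u i 0 + \<mu> * on_mesh xL dx \<tau> f i 1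
              else (\<Sum>s = 0..k - 1. (l_coeff \<gamma> s - l_coeff \<gamma> (s + 1)) * u i (k - s))
                     + l_coeff \<gamma> k * u i 0 + \<mu> * on_mesh xL dx \<tau> f i (k + 1)))"

definition mesh_norm :: "nat \<Rightarrow> (nat \<Rightarrow> real) \<Rightarrow> real" where
  "mesh_norm N v = Max ((\<lambda>i. \<bar>v i\<bar>) ` {0..N})"

text \<open>Stability under a restriction \<open>R\<close> on the step sizes \<open>\<tau>\<close>, \<open>dx\<close>: a perturbation of
  the initial values is propagated with a constant \<open>C\<close> that is uniform in the mesh, the
  time level and the two solutions.\<close>

definition implicit_scheme_stable_under ::
    "(real \<Rightarrow> real \<Rightarrow> bool) \<Rightarrow> real \<Rightarrow> real \<Rightarrow> real \<Rightarrow> real \<Rightarrow> real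
       \<Rightarrow> (real \<Rightarrow> real \<Rightarrow> real) \<Rightarrow> (real \<Rightarrow> real \<Rightarrow> real) \<Rightarrow> bool" where
  "implicit_scheme_stable_under R \<gamma> \<alpha> xL xR T c f \<longleftrightarrow>
     (\<exists>C. \<forall>Nx\<ge>1. \<forall>Nt\<ge>1. R (step T Nt) (step (xR - xL) Nx) \<longrightarrow>
        (\<forall>u u'. solves_implicit_scheme \<gamma> \<alpha> xL xR T c f Nx Nt u \<longrightarrow>
                solves_implicit_scheme \<gamma> \<alpha> xL xR T c f Nx Nt u' \<longrightarrow>
           (\<forall>k\<le>Nt. mesh_norm Nx (\<lambda>i. u' i k - u i k)
                     \<le> C * mesh_norm Nx (\<lambda>i. u' i 0 - u i 0))))"

definition implicit_scheme_unconditionally_stable ::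
    "real \<Rightarrow> real \<Rightarrow> real \<Rightarrow> real \<Rightarrow> real
       \<Rightarrow> (real \<Rightarrow> real \<Rightarrow> real) \<Rightarrow> (real \<Rightarrow> real \<Rightarrow> real) \<Rightarrow> bool" where
  "implicit_scheme_unconditionally_stable = implicit_scheme_stable_under (\<lambda>\<tau> dx. True)"

end

theory Submission
  imports Defs
begin

text \<open>
  After reflection at the midpoint of the mesh, \<open>q\<close> becomes \<open>p\<close>, and \<open>p\<close> consists of second
  differences in the first index of \<open>a\<close>. The off-diagonal entries of \<open>g\<close> are nonnegative, because
  they are fourth differences of \<open>x\<^sup>s\<close>, \<open>s = 3 - \<nu> \<in> [1, 2)\<close>, or second differences of the remainder
  \<open>(x - 1)\<^sup>s - x\<^sup>s + s x\<^sup>s\<^sup>-\<^sup>1\<close>, up to small cases. The matrix of the scheme is however not diagonally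
  dominant: for \<open>\<nu>\<close> close to 1 the rows \<open>1\<close> and \<open>N - 1\<close> of \<open>g\<close> have positive sums, so errors may
  grow in the maximum norm. Dominance is restored by the weights 1 at the two end points and
  \<open>1 + 1 / (4 - 2\<^sup>s)\<close> in the interior. The scheme hence contracts the weighted maximum norm (the
  time coefficients \<open>l\<^sub>s - l\<^sub>s\<^sub>+\<^sub>1\<close> and \<open>l\<^sub>k\<close> form a convex combination), and this norm is equivalent
  to the maximum norm uniformly in the mesh.
\<close>

subsection \<open>Differences of powers\<close>

text \<open>Both first differences are values of \<open>f'\<close> at intermediate points, which lie
  in adjacent unit intervals and are therefore ordered. Differentiability is asked for only in the
  interior, so that powers with infinite slope at \<open>a = 0\<close> are covered.\<close>

lemma second_difference_nonneg:
  fixes f f' :: "real \<Rightarrow> real"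
  assumes cont: "continuous_on {a..a + 2} f"
    and der: "\<And>x. a < x \<Longrightarrow> x < a + 2 \<Longrightarrow> (f has_real_derivative f' x) (at x)"
    and mono: "\<And>x y. a < x \<Longrightarrow> x \<le> y \<Longrightarrow> y < a + 2 \<Longrightarrow> f' x \<le> f' y"
  shows "0 \<le> f a - 2 * f (a + 1) + f (a + 2)"
proof -
  have mvt: "\<exists>z. b < z \<and> z < b + 1 \<and> f (b + 1) - f b = f' z" if "a \<le> b" "b \<le> a + 1" for b
  proof -
    have "\<exists>l z. b < z \<and> z < b + 1 \<and> (f has_real_derivative l) (at z)
        \<and> f (b + 1) - f b = (b + 1 - b) * l"
    proof (rule MVT)
      show "continuous_on {b..b + 1} f"
        using that by (intro continuous_on_subset[OF cont]) auto
      show "f differentiable (at x)" if "b < x" "x < b + 1" for x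
        using that \<open>a \<le> b\<close> \<open>b \<le> a + 1\<close> der[of x] by (auto simp: real_differentiable_def)
    qed simp
    then obtain l z where "b < z" "z < b + 1" "(f has_real_derivative l) (at z)"
      "f (b + 1) - f b = l" by auto
    moreover have "l = f' z"
      using calculation that by (intro DERIV_unique[OF _ der]) auto
    ultimately show ?thesis by blast
  qed
  obtain x where "a < x" "x < a + 1" "f (a + 1) - f a = f' x"
    using mvt[of a] by auto
  moreover obtain y where "a + 1 < y" "y < a + 2" "f (a + 2) - f (a + 1) = f' y"
    using mvt[of "a + 1"] by (auto simp: add.assoc)
  ultimately show ?thesis
    using mono[of x y] by simp
qed

text \<open>Concavity of \<open>x powr q\<close>. Since \<open>0 powr 0 = 0\<close>, the function
  jumps at 0 when \<open>q = 0\<close>; the last assumption keeps it continuous on the closed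
  interval.\<close>

lemma second_difference_powr_nonpos:
  fixes a q :: real
  assumes "0 \<le> q" "q \<le> 1" "0 \<le> a" "a = 0 \<Longrightarrow> 0 < q"
  shows "a powr q - 2 * (a + 1) powr q + (a + 2) powr q \<le> 0"
proof -
  have "0 \<le> (\<lambda>x. - (x powr q)) a - 2 * (\<lambda>x. - (x powr q)) (a + 1) + (\<lambda>x. - (x powr q)) (a + 2)"
  proof (rule second_difference_nonneg[where f' = "\<lambda>x. - (q * x powr (q - 1))"])
    show "continuous_on {a..a + 2} (\<lambda>x. - (x powr q))"
      using assms by (intro continuous_intros continuous_on_powr') (auto simp: order_le_less)
  next
    fix x assume "a < x"
    then show "((\<lambda>x. - (x powr q)) has_real_derivative - (q * x powr (q - 1))) (at x)"
      using assms by (auto intro!: derivative_eq_intros)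
  next
    fix x y assume "a < x" "x \<le> y"
    then show "- (q * x powr (q - 1)) \<le> - (q * y powr (q - 1))"
      using assms by (auto intro!: mult_left_mono powr_mono2')
  qed
  then show ?thesis by simp
qed

lemma second_difference_powr_nonneg:
  fixes a q :: real
  assumes "q \<le> 0" "0 < a"
  shows "0 \<le> a powr q - 2 * (a + 1) powr q + (a + 2) powr q"
proof (rule second_difference_nonneg[where f' = "\<lambda>x. q * x powr (q - 1)"])
  show "continuous_on {a..a + 2} (\<lambda>x. x powr q)"
    using assms by (intro continuous_intros) auto
next
  fix x assume "a < x"
  then show "((\<lambda>x. x powr q) has_real_derivative q * x powr (q - 1)) (at x)"
    using assms by (auto intro!: derivative_eq_intros)
next
  fix x y assume "a < x" "x \<le> y"
  then show "q * x powr (q - 1) \<le> q * y powr (q - 1)"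
    using assms by (auto intro!: mult_left_mono_neg powr_mono2')
qed

text \<open>This is the second difference of the second difference \<open>?A\<close>, which is
  convex because \<open>?A''\<close> is \<open>s * (s - 1)\<close> times a second difference of the
  convex function \<open>x powr (s - 2)\<close>.\<close>

lemma fourth_difference_powr_nonneg:
  fixes a s :: real
  assumes "1 \<le> s" "s \<le> 2" "0 \<le> a"
  shows "0 \<le> a powr s - 4 * (a + 1) powr s + 6 * (a + 2) powr s - 4 * (a + 3) powr s
    + (a + 4) powr s"
proof -
  let ?A = "\<lambda>x::real. (x + 2) powr s - 2 * (x + 1) powr s + x powr s"
  let ?A' = "\<lambda>x::real. s * ((x + 2) powr (s - 1) - 2 * (x + 1) powr (s - 1) + x powr (s - 1))"
  let ?A'' = "\<lambda>x::real. s * ((s - 1) * (x powr (s - 2) - 2 * (x + 1) powr (s - 2)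
    + (x + 2) powr (s - 2)))"
  have "0 \<le> ?A a - 2 * ?A (a + 1) + ?A (a + 2)"
  proof (rule second_difference_nonneg[where f' = ?A'])
    show "continuous_on {a..a + 2} ?A"
      using assms by (intro continuous_intros continuous_on_powr') auto
  next
    fix x assume "a < x"
    then show "(?A has_real_derivative ?A' x) (at x)"
      using assms by (auto intro!: derivative_eq_intros simp: algebra_simps)
  next
    fix x y assume xy: "a < x" "x \<le> y"
    show "?A' x \<le> ?A' y"
    proof (rule DERIV_nonneg_imp_nondecreasing[OF xy(2)])
      fix z assume "x \<le> z"
      then have "0 < z" using xy assms by simp
      then have "(?A' has_real_derivative ?A'' z) (at z)"
        using assms by (auto intro!: derivative_eq_intros simp: algebra_simps)
      moreover have "0 \<le> ?A'' z"
        using assms \<open>0 < z\<close> second_difference_powr_nonneg[of "s - 2" z]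
        by (intro mult_nonneg_nonneg) auto
      ultimately show "\<exists>d. (?A' has_real_derivative d) (at z) \<and> 0 \<le> d"
        by blast
    qed
  qed
  then show ?thesis by (simp add: algebra_simps)
qed

text \<open>A convex function lies above its tangent at \<open>x\<close>, here evaluated at
  \<open>x - 1\<close>.\<close>

lemma powr_tangent_bound:
  fixes x q :: real
  assumes "q \<le> 0" "1 < x"
  shows "x powr q - q * x powr (q - 1) \<le> (x - 1) powr q"
proof -
  have "\<exists>z. x - 1 < z \<and> z < x \<and> x powr q - (x - 1) powr q = (x - (x - 1)) * (q * z powr (q - 1))"
    using assms by (intro MVT2) (auto intro!: derivative_eq_intros)
  then obtain z where z: "x - 1 < z" "z < x" "x powr q - (x - 1) powr q = q * z powr (q - 1)"
    by auto
  have "q * z powr (q - 1) \<le> q * x powr (q - 1)"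
    using assms z by (intro mult_left_mono_neg powr_mono2') auto
  with z show ?thesis by simp
qed

text \<open>\<open>B x\<close> is the error at \<open>x - 1\<close> of the tangent to the power
  function at \<open>x\<close>. Its convexity is \<open>powr_tangent_bound\<close> for the exponent
  \<open>s - 2\<close>. With \<open>s = 3 - \<nu>\<close> it describes column 0 of
  \<open>a_coeff\<close>.\<close>

lemma powr_remainder_second_difference_nonneg:
  fixes a s :: real
  assumes "1 \<le> s" "s \<le> 2" "1 \<le> a"
  defines "B \<equiv> \<lambda>x::real. (x - 1) powr s - x powr s + s * x powr (s - 1)"
  shows "0 \<le> B a - 2 * B (a + 1) + B (a + 2)"
proof -
  let ?B' = "\<lambda>x::real. s * ((x - 1) powr (s - 1) - x powr (s - 1) + (s - 1) * x powr (s - 2))"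
  let ?B'' = "\<lambda>x::real. s * ((s - 1) * ((x - 1) powr (s - 2) - x powr (s - 2)
    + (s - 2) * x powr (s - 3)))"
  show ?thesis
  proof (rule second_difference_nonneg[where f' = ?B'])
    show "continuous_on {a..a + 2} B"
      unfolding B_def using assms
      by (intro continuous_intros continuous_on_powr') auto
  next
    fix x assume "a < x"
    then show "(B has_real_derivative ?B' x) (at x)"
      unfolding B_def using assms by (auto intro!: derivative_eq_intros simp: algebra_simps)
  next
    fix x y assume xy: "a < x" "x \<le> y"
    show "?B' x \<le> ?B' y"
    proof (rule DERIV_nonneg_imp_nondecreasing[OF xy(2)])
      fix z assume "x \<le> z"
      then have "1 < z" using xy assms by simp
      then have "(?B' has_real_derivative ?B'' z) (at z)"
        using assms by (auto intro!: derivative_eq_intros simp: algebra_simps)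
      moreover have "0 \<le> ?B'' z"
        using assms \<open>1 < z\<close> powr_tangent_bound[of "s - 2" z]
        by (intro mult_nonneg_nonneg) auto
      ultimately show "\<exists>d. (?B' has_real_derivative d) (at z) \<and> 0 \<le> d"
        by blast
    qed
  qed
qed

text \<open>The expression is nonincreasing for \<open>s \<le> 2\<close> and vanishes at
  \<open>s = 2\<close>. It controls the subdiagonal entries of \<open>p_coeff\<close>.\<close>

lemma three_powr_bound:
  fixes s :: real
  assumes "s \<le> 2"
  shows "0 \<le> 3 powr s - 4 * 2 powr s + 7"
proof -
  let ?h = "\<lambda>s::real. 3 powr s - 4 * 2 powr s + 7"
  \<comment> \<open>As \<open>(3/2) powr z\<close> is at most 9/4, the derivative is at most
    \<open>2 powr z * (9/4 * ln 3 - 4 * ln 2)\<close>; its sign is settled by 19683 < 65536.\<close>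
  have "ln (3 ^ 9) \<le> (ln (2 ^ 16) :: real)"
    by (subst ln_le_cancel_iff) auto
  then have l: "9 * ln 3 \<le> 16 * (ln 2 :: real)"
    by (subst (asm) (1 2) ln_realpow) auto
  have "?h 2 \<le> ?h s"
  proof (rule DERIV_nonpos_imp_nonincreasing[OF assms])
    fix z :: real assume z: "z \<le> 2"
    have "(?h has_real_derivative (3 powr z * ln 3 - 4 * (2 powr z * ln 2))) (at z)"
      by (auto intro!: derivative_eq_intros)
    moreover have "3 powr z * ln 3 - 4 * (2 powr z * ln 2) \<le> 0"
    proof -
      have "(3/2) powr z \<le> (3/2) powr (2::real)"
        using z by (intro powr_mono) auto
      then have "3 powr z \<le> 9/4 * 2 powr z"
        by (simp add: powr_divide power_divide field_simps)
      then have "3 powr z * ln 3 \<le> 9/4 * 2 powr z * ln 3"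
        by (intro mult_right_mono) auto
      also have "\<dots> = 2 powr z * (9 * ln 3) / 4" by simp
      also have "\<dots> \<le> 2 powr z * (16 * ln 2) / 4"
        using l by (intro divide_right_mono mult_left_mono) auto
      finally show ?thesis by (simp add: mult_ac)
    qed
    ultimately show "\<exists>d. (?h has_real_derivative d) (at z) \<and> d \<le> 0"
      by blast
  qed
  then show ?thesis by simp
qed

subsection \<open>Space coefficients\<close>

lemma a_coeff_above_diagonal: "0 \<le> m \<Longrightarrow> j < m \<Longrightarrow> a_coeff \<nu> j m = 0"
  by (simp add: a_coeff_def)

lemma b_coeff_mirror: "b_coeff \<nu> N j m = a_coeff \<nu> (N - j) (N - m)"
  by (auto simp: b_coeff_def a_coeff_def algebra_simps)

lemma q_coeff_mirror: "q_coeff \<nu> N i m = p_coeff \<nu> (N - i) (N - m)"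
  by (auto simp: p_coeff_def q_coeff_def b_coeff_mirror algebra_simps)

lemma g_coeff_eq_p_coeff:
  assumes "i \<le> N" "m \<le> N"
  shows "g_coeff \<nu> N i m
    = p_coeff \<nu> (int i) (int m) + p_coeff \<nu> (int (N - i)) (int (N - m))"
  using assms by (simp add: g_coeff_def q_coeff_mirror of_nat_diff)

lemma g_coeff_mirror:
  assumes "i \<le> N" "m \<le> N"
  shows "g_coeff \<nu> N (N - i) (N - m) = g_coeff \<nu> N i m"
  using assms by (simp add: g_coeff_eq_p_coeff)

text \<open>The cases in the definition of \<open>p_coeff\<close> only suppress entries of
  \<open>a_coeff\<close> above the diagonal, where the default value 0 makes the uniform formula
  valid.\<close>

lemma p_coeff_second_difference:
  assumes "0 \<le> m"
  shows "p_coeff \<nu> i m = a_coeff \<nu> (i - 1) m - 2 * a_coeff \<nu> i m + a_coeff \<nu> (i + 1) m"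
  using assms by (auto simp: p_coeff_def a_coeff_above_diagonal)

text \<open>Splitting one factor \<open>j\<close> off \<open>j powr (3 - \<nu>)\<close> exhibits
  column 0 as the tangent remainder \<open>B j\<close> for \<open>s = 3 - \<nu>\<close>.\<close>

lemma a_coeff_0:
  assumes "1 \<le> j"
  shows "a_coeff \<nu> j 0 = (real_of_int j - 1) powr (3 - \<nu>) - real_of_int j powr (3 - \<nu>)
    + (3 - \<nu>) * real_of_int j powr (2 - \<nu>)"
proof -
  have "real_of_int j powr (3 - \<nu>) = real_of_int j powr (1 + (2 - \<nu>))"
    by simp
  also have "\<dots> = real_of_int j * real_of_int j powr (2 - \<nu>)"
    using assms by (subst powr_add) simp
  finally show ?thesis
    using assms by (simp add: a_coeff_def algebra_simps)
qed

lemma a_coeff_below_diagonal: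
  assumes "1 \<le> m" "m < j"
  shows "a_coeff \<nu> j m = (real_of_int (j - m) + 1) powr (3 - \<nu>)
    - 2 * real_of_int (j - m) powr (3 - \<nu>) + (real_of_int (j - m) - 1) powr (3 - \<nu>)"
  using assms by (simp add: a_coeff_def)

section \<open>Row sums of \<open>a_coeff\<close> and \<open>p_coeff\<close>\<close>

text \<open>Away from column 0 the entries are second differences in \<open>m\<close>, so the sum
  telescopes; column 0 supplies the remaining boundary terms.\<close>

lemma a_coeff_partial_sum:
  assumes "n < j"
  shows "(\<Sum>m = 0..n. a_coeff \<nu> (int j) (int m))
    = (3 - \<nu>) * real j powr (2 - \<nu>) - (real j - real n) powr (3 - \<nu>)
      + (real j - real n - 1) powr (3 - \<nu>)"
  using assms
proof (induction n)
  case 0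
  then show ?case by (simp add: a_coeff_0)
next
  case (Suc n)
  then show ?case
    by (simp add: a_coeff_below_diagonal) (simp add: algebra_simps)
qed

text \<open>The partial sum up to column \<open>j - 1\<close> ends in
  \<open>- 1 powr (3 - \<nu>) + 0 powr (3 - \<nu>)\<close>, that is -1, which the diagonal entry 1
  cancels.\<close>

lemma a_coeff_sum:
  assumes "1 \<le> j" "j \<le> n"
  shows "(\<Sum>m = 0..n. a_coeff \<nu> (int j) (int m)) = (3 - \<nu>) * real j powr (2 - \<nu>)"
proof -
  have "(\<Sum>m = 0..n. a_coeff \<nu> (int j) (int m)) = (\<Sum>m = 0..j. a_coeff \<nu> (int j) (int m))"
    using assms by (intro sum.mono_neutral_right) (auto simp: a_coeff_above_diagonal)
  also obtain i where "j = Suc i"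
    using assms by (cases j) auto
  then have "(\<Sum>m = 0..j. a_coeff \<nu> (int j) (int m)) = (3 - \<nu>) * real j powr (2 - \<nu>)"
    using a_coeff_partial_sum[of i j \<nu>] by (simp add: a_coeff_def)
  finally show ?thesis .
qed

text \<open>The second difference in \<open>i\<close> of the row sums of \<open>a_coeff\<close>,
  hence the row sum of \<open>p_coeff\<close> in the generic rows.\<close>

definition scaled_second_difference :: "real \<Rightarrow> nat \<Rightarrow> real" where
  "scaled_second_difference \<nu> i = (3 - \<nu>)
    * ((real i - 1) powr (2 - \<nu>) - 2 * real i powr (2 - \<nu>) + (real i + 1) powr (2 - \<nu>))"

text \<open>Rows -1, 0 and 1 of \<open>a_coeff\<close> have the sums 0 (default values only), 1 and
  \<open>3 - \<nu>\<close>.\<close>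

lemma p_coeff_row_sum_0:
  assumes "1 \<le> N"
  shows "(\<Sum>m = 0..N. p_coeff \<nu> 0 (int m)) = 1 - \<nu>"
proof -
  have "(\<Sum>m = 0..N. a_coeff \<nu> (- 1) (int m)) = 0"
    by (intro sum.neutral) (auto simp: a_coeff_def)
  moreover have "(\<Sum>m = 0..N. a_coeff \<nu> 0 (int m)) = (\<Sum>m\<in>{0}. a_coeff \<nu> 0 (int m))"
    by (intro sum.mono_neutral_right) (auto simp: a_coeff_def)
  moreover have "(\<Sum>m = 0..N. a_coeff \<nu> 1 (int m)) = 3 - \<nu>"
    using a_coeff_sum[of 1 N \<nu>] assms by simp
  ultimately show ?thesis
    by (simp add: p_coeff_second_difference sum.distrib sum_subtractf
        flip: sum_distrib_left) (simp add: a_coeff_def)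
qed

text \<open>The entry \<open>m = i + 1\<close> of row \<open>i\<close>, which equals 1, is cut off by the boundary
  if \<open>i = N\<close>. The case \<open>i = 1\<close> is special because of the value \<open>a\<^sub>0\<^sub>,\<^sub>0 = 1\<close>, where the general
  formula for the row sums of \<open>a\<close> gives 0.\<close>

lemma p_coeff_row_sum:
  assumes "1 \<le> i" "i \<le> N"
  shows "(\<Sum>m = 0..N. p_coeff \<nu> (int i) (int m))
    = (if i = 1 then 1 - 2 * (3 - \<nu>) + (3 - \<nu>) * 2 powr (2 - \<nu>)
       else scaled_second_difference \<nu> i) - (if i = N then 1 else 0)"
proof -
  have lo: "(\<Sum>m = 0..N. a_coeff \<nu> (int i - 1) (int m))
    = (if i = 1 then 1 else (3 - \<nu>) * (real i - 1) powr (2 - \<nu>))"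
  proof (cases "i = 1")
    case True
    have "(\<Sum>m = 0..N. a_coeff \<nu> 0 (int m)) = (\<Sum>m\<in>{0}. a_coeff \<nu> 0 (int m))"
      by (intro sum.mono_neutral_right) (auto simp: a_coeff_def)
    with True show ?thesis by (simp add: a_coeff_def)
  next
    case False
    then show ?thesis
      using a_coeff_sum[of "i - 1" N \<nu>] assms by (simp add: of_nat_diff)
  qed
  have mid: "(\<Sum>m = 0..N. a_coeff \<nu> (int i) (int m)) = (3 - \<nu>) * real i powr (2 - \<nu>)"
    using assms by (intro a_coeff_sum)
  have hi: "(\<Sum>m = 0..N. a_coeff \<nu> (int i + 1) (int m))
    = (3 - \<nu>) * (real i + 1) powr (2 - \<nu>) - (if i = N then 1 else 0)"
    using a_coeff_sum[of "i + 1" N \<nu>] a_coeff_partial_sum[of N "i + 1" \<nu>] assms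
    by (cases "i = N") (simp_all add: add.commute)
  have "(\<Sum>m = 0..N. p_coeff \<nu> (int i) (int m))
    = (\<Sum>m = 0..N. a_coeff \<nu> (int i - 1) (int m)) - 2 * (\<Sum>m = 0..N. a_coeff \<nu> (int i) (int m))
      + (\<Sum>m = 0..N. a_coeff \<nu> (int i + 1) (int m))"
    by (simp add: p_coeff_second_difference sum.distrib sum_subtractf flip: sum_distrib_left)
  then show ?thesis
    unfolding lo mid hi by (auto simp: scaled_second_difference_def algebra_simps)
qed

section \<open>Signs of the entries of \<open>p_coeff\<close> and \<open>g_coeff\<close>\<close>

lemma p_coeff_superdiagonal:
  shows "0 \<le> i \<Longrightarrow> p_coeff \<nu> i (i + 1) = 1"
  and "0 \<le> m \<Longrightarrow> i + 1 < m \<Longrightarrow> p_coeff \<nu> i m = 0"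
  by (simp_all add: p_coeff_def a_coeff_def)

lemma p_coeff_diagonal:
  assumes "1 \<le> i"
  shows "p_coeff \<nu> i i = 2 powr (3 - \<nu>) - 4"
  using assms by (simp add: p_coeff_second_difference a_coeff_above_diagonal)
    (simp add: a_coeff_def)

lemma p_coeff_0_0: "p_coeff \<nu> 0 0 = - \<nu>"
  by (simp add: p_coeff_def a_coeff_def)

lemma p_coeff_1_0: "p_coeff \<nu> 1 0 = (\<nu> - 1) * (2 - 2 powr (2 - \<nu>))"
  by (simp add: p_coeff_def a_coeff_def algebra_simps)

text \<open>All three rows involved lie strictly below the diagonal. Column 0 gives a second
  difference of the tangent remainder; in the other columns \<open>a_coeff\<close> is itself a
  second difference, which makes a fourth difference of powers.\<close>

lemma p_coeff_nonneg:
  assumes "1 < \<nu>" "\<nu> \<le> 2" and "0 \<le> m" "m + 2 \<le> i"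
  shows "0 \<le> p_coeff \<nu> i m"
proof (cases "m = 0")
  case True
  have "i - 1 \<ge> 1" using assms True by simp
  then have "1 \<le> real_of_int (i - 1)" by linarith
  from powr_remainder_second_difference_nonneg[OF _ _ this, of "3 - \<nu>"] show ?thesis
    using assms True by (simp add: p_coeff_second_difference a_coeff_0 algebra_simps)
next
  case False
  show ?thesis
    using fourth_difference_powr_nonneg[of "3 - \<nu>" "real_of_int (i - m) - 2"] assms False
    by (simp add: p_coeff_second_difference a_coeff_below_diagonal algebra_simps)
qed

text \<open>The entry may be negative; the bound -1 is what the superdiagonal entry 1 of the
  mirrored matrix can compensate in \<open>g_coeff\<close>. Row 1 is separate, as its subdiagonal
  entry lies in column 0.\<close>

lemma p_coeff_subdiagonal:
  assumes "1 < \<nu>" "\<nu> \<le> 2" and "1 \<le> i"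
  shows "- 1 \<le> p_coeff \<nu> i (i - 1)"
proof (cases "i = 1")
  case True
  have "2 powr (2 - \<nu>) \<le> 2 powr 1"
    using assms by (intro powr_mono) auto
  then have "0 \<le> (\<nu> - 1) * (2 - 2 powr (2 - \<nu>))"
    using assms by (intro mult_nonneg_nonneg) auto
  with True show ?thesis by (simp add: p_coeff_1_0)
next
  case False
  then have "p_coeff \<nu> i (i - 1) = 3 powr (3 - \<nu>) - 4 * 2 powr (3 - \<nu>) + 6"
    using assms
    by (simp add: p_coeff_second_difference a_coeff_below_diagonal) (simp add: a_coeff_def)
  with three_powr_bound[of "3 - \<nu>"] assms show ?thesis by simp
qed

text \<open>Below the diagonal the mirrored part contributes 1 next to the diagonal and 0 further
  away, so the bounds on \<open>p_coeff\<close> suffice. The entries above the diagonal follow by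
  reflection.\<close>

lemma g_coeff_off_diagonal_nonneg:
  assumes \<nu>: "1 < \<nu>" "\<nu> \<le> 2" and "i \<le> N" "m \<le> N" "m \<noteq> i"
  shows "0 \<le> g_coeff \<nu> N i m"
proof -
  have lower: "0 \<le> g_coeff \<nu> N i m" if "i \<le> N" "m < i" for i m
  proof (cases "m + 1 = i")
    case True
    then have "p_coeff \<nu> (int (N - i)) (int (N - m)) = 1"
      using that p_coeff_superdiagonal(1)[of "int (N - i)" \<nu>] by (auto simp: of_nat_diff algebra_simps)
    then show ?thesis
      using p_coeff_subdiagonal[OF \<nu>, of "int i"] that True
      by (auto simp: g_coeff_eq_p_coeff)
  next
    case False
    then have "p_coeff \<nu> (int (N - i)) (int (N - m)) = 0"
      using that by (intro p_coeff_superdiagonal(2)) auto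
    then show ?thesis
      using p_coeff_nonneg[OF \<nu>, of "int m" "int i"] that False
      by (auto simp: g_coeff_eq_p_coeff)
  qed
  show ?thesis
  proof (cases "m < i")
    case False
    then have "0 \<le> g_coeff \<nu> N (N - i) (N - m)"
      using assms by (intro lower) auto
    with assms show ?thesis by (simp add: g_coeff_mirror)
  qed (use assms lower in auto)
qed

subsection \<open>Weighted row sums\<close>

text \<open>The denominator is the negative of the diagonal entry of \<open>p_coeff\<close> in rows
  \<open>i \<ge> 1\<close>. The excess times this denominator is 1, the largest surplus a row sum
  has to be relieved of. It depends on \<nu> but not on the mesh.\<close>

definition weight_excess :: "real \<Rightarrow> real" where
  "weight_excess \<nu> = 1 / (4 - 2 powr (3 - \<nu>))"

definition weight :: "real \<Rightarrow> nat \<Rightarrow> nat \<Rightarrow> real" where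
  "weight \<nu> N i = (if i = 0 \<or> i = N then 1 else 1 + weight_excess \<nu>)"

lemma weight_excess_pos:
  assumes "1 < \<nu>"
  shows "0 < weight_excess \<nu>"
proof -
  have "2 powr (3 - \<nu>) < 2 powr (2::real)"
    using assms by (intro powr_less_mono) auto
  then show ?thesis by (simp add: weight_excess_def)
qed

text \<open>Concavity of \<open>x powr (2 - \<nu>)\<close>; the base point \<open>i - 1\<close> is
  positive, which admits the exponent 0 at \<open>\<nu> = 2\<close>.\<close>

lemma scaled_second_difference_nonpos:
  assumes "1 < \<nu>" "\<nu> \<le> 2" "2 \<le> i"
  shows "scaled_second_difference \<nu> i \<le> 0"
  using assms second_difference_powr_nonpos[of "2 - \<nu>" "real i - 1"]
  by (auto simp: scaled_second_difference_def add.commute intro!: mult_nonneg_nonpos)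

text \<open>Every index first gets the interior weight, then the two end points, distinct by
  \<open>1 \<le> N\<close>, are corrected.\<close>

lemma weighted_sum:
  fixes f :: "nat \<Rightarrow> real"
  assumes "1 \<le> N"
  shows "(\<Sum>m = 0..N. f m * weight \<nu> N m)
    = (1 + weight_excess \<nu>) * (\<Sum>m = 0..N. f m) - weight_excess \<nu> * (f 0 + f N)"
proof -
  have "f m * weight \<nu> N m
    = (1 + weight_excess \<nu>) * f m - weight_excess \<nu> * (if m \<in> {0, N} then f m else 0)" for m
    by (auto simp: weight_def algebra_simps)
  then have "(\<Sum>m = 0..N. f m * weight \<nu> N m) = (1 + weight_excess \<nu>) * (\<Sum>m = 0..N. f m)
      - weight_excess \<nu> * (\<Sum>m = 0..N. if m \<in> {0, N} then f m else 0)"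
    by (simp add: sum_subtractf flip: sum_distrib_left)
  also have "(\<Sum>m = 0..N. if m \<in> {0, N} then f m else 0) = (\<Sum>m\<in>{0, N}. f m)"
    by (subst sum.inter_restrict[symmetric]) (auto intro!: sum.cong)
  also have "\<dots> = f 0 + f N"
    using assms by simp
  finally show ?thesis .
qed

lemma g_coeff_row_sum:
  assumes "i \<le> N"
  shows "(\<Sum>m = 0..N. g_coeff \<nu> N i m)
    = (\<Sum>m = 0..N. p_coeff \<nu> (int i) (int m)) + (\<Sum>m = 0..N. p_coeff \<nu> (int (N - i)) (int m))"
proof -
  have "(\<Sum>m = 0..N. p_coeff \<nu> (int (N - i)) (int m))
    = (\<Sum>m = 0..N. p_coeff \<nu> (int (N - i)) (int (N - m)))"
    by (subst sum.atLeastAtMost_rev) simp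
  then show ?thesis
    using assms by (simp add: g_coeff_eq_p_coeff sum.distrib)
qed

lemma row_one_sum_le:
  fixes \<nu> :: real
  assumes "1 < \<nu>" "\<nu> \<le> 2"
  shows "1 - 2 * (3 - \<nu>) + (3 - \<nu>) * 2 powr (2 - \<nu>) \<le> 1"
proof -
  have "2 powr (2 - \<nu>) \<le> 2 powr 1"
    using assms by (intro powr_mono) auto
  then have "(3 - \<nu>) * 2 powr (2 - \<nu>) \<le> (3 - \<nu>) * 2"
    using assms by (intro mult_left_mono) auto
  then show ?thesis by simp
qed

text \<open>For \<open>N \<ge> 2\<close>, with \<open>?d * (4 - 2 powr (3 - \<nu>)) = 1\<close>, the
  weighted sum equals \<open>1 - \<nu> + (1 + ?d) * scaled_second_difference \<nu> N - ?d * g_coeff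
  \<nu> N 0 N\<close>, where no term is positive. For \<open>N = 1\<close> there are no interior
  points and all weights are 1.\<close>

lemma g_coeff_weighted_row_sum_0:
  assumes \<nu>: "1 < \<nu>" "\<nu> \<le> 2" and N: "1 \<le> N"
  shows "(\<Sum>m = 0..N. g_coeff \<nu> N 0 m * weight \<nu> N m) \<le> 0"
proof (cases "N = 1")
  case True
  then have "(\<Sum>m = 0..N. g_coeff \<nu> N 0 m * weight \<nu> N m) = (\<Sum>m = 0..N. g_coeff \<nu> N 0 m)"
    by (simp add: weight_def)
  also have "\<dots> = (1 - \<nu>) + (1 - 2 * (3 - \<nu>) + (3 - \<nu>) * 2 powr (2 - \<nu>) - 1)"
    using p_coeff_row_sum_0[OF N] p_coeff_row_sum[of N N \<nu>] True by (subst g_coeff_row_sum) auto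
  also have "\<dots> \<le> 0"
    using row_one_sum_le[OF \<nu>] \<nu> by simp
  finally show ?thesis .
next
  case False
  let ?d = "weight_excess \<nu>"
  have d: "0 < ?d" "?d * (4 - 2 powr (3 - \<nu>)) = 1"
    using weight_excess_pos[OF \<nu>(1)] by (auto simp: weight_excess_def)
  have row: "(\<Sum>m = 0..N. g_coeff \<nu> N 0 m) = - \<nu> + scaled_second_difference \<nu> N"
    using p_coeff_row_sum_0[OF N] p_coeff_row_sum[of N N \<nu>] False N by (subst g_coeff_row_sum) auto
  have g0: "g_coeff \<nu> N 0 0 = - \<nu> + (2 powr (3 - \<nu>) - 4)"
    using N by (simp add: g_coeff_eq_p_coeff p_coeff_0_0 p_coeff_diagonal)
  have "0 \<le> g_coeff \<nu> N 0 N"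
    using g_coeff_off_diagonal_nonneg[OF \<nu>, of 0 N N] N by simp
  then have "0 \<le> ?d * g_coeff \<nu> N 0 N"
    using d by simp
  moreover have "(1 + ?d) * scaled_second_difference \<nu> N \<le> 0"
    using scaled_second_difference_nonpos[OF \<nu>, of N] False N d by (intro mult_nonneg_nonpos) auto
  ultimately show ?thesis
    using d(2) \<nu> unfolding weighted_sum[OF N] row g0 by (simp add: algebra_simps)
qed

text \<open>This is half of an interior row of \<open>g_coeff\<close>: adding the bounds for
  \<open>i\<close> and \<open>N - i\<close> gives the weighted row sum. From \<open>i = 2\<close>
  on, the left side is nonpositive and the right side nonnegative, so only \<open>i = 1\<close> is
  delicate.\<close>

lemma p_coeff_weighted_row_bound:
  assumes \<nu>: "1 < \<nu>" "\<nu> \<le> 2" and i: "1 \<le> i" "i < N"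
  shows "(1 + weight_excess \<nu>) * (\<Sum>m = 0..N. p_coeff \<nu> (int i) (int m))
    \<le> weight_excess \<nu> * (p_coeff \<nu> (int i) 0 + p_coeff \<nu> (int (N - i)) (int N))"
proof (cases "i = 1")
  case True
  let ?d = "weight_excess \<nu>"
  have d: "?d * (4 - 2 powr (3 - \<nu>)) = 1"
    using weight_excess_pos[OF \<nu>(1)] by (auto simp: weight_excess_def)
  have "p_coeff \<nu> (int (N - 1)) (int N) = 1"
    using p_coeff_superdiagonal(1)[of "int (N - 1)" \<nu>] i by (simp add: of_nat_diff)
  moreover define R where "R = 1 - 2 * (3 - \<nu>) + (3 - \<nu>) * 2 powr (2 - \<nu>)"
  have sum: "(\<Sum>m = 0..N. p_coeff \<nu> 1 (int m)) = R"
    using p_coeff_row_sum[of 1 N \<nu>] i by (simp add: R_def)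
  have "2 powr (3 - \<nu>) = 2 * 2 powr (2 - \<nu>)"
    using powr_add[of 2 1 "2 - \<nu>"] by simp
  \<comment> \<open>By this identity the claim reduces to
    \<open>R \<le> ?d * (4 - 2 powr (3 - \<nu>))\<close>, whose right side is 1 by the choice of the
    excess.\<close>
  then have "(\<nu> - 1) * (2 - 2 powr (2 - \<nu>)) + 1 = (4 - 2 powr (3 - \<nu>)) + R"
    by (simp add: R_def algebra_simps)
  ultimately have "p_coeff \<nu> (int i) 0 + p_coeff \<nu> (int (N - i)) (int N)
    = (4 - 2 powr (3 - \<nu>)) + R"
    using True by (simp add: p_coeff_1_0)
  then have "?d * (p_coeff \<nu> (int i) 0 + p_coeff \<nu> (int (N - i)) (int N))
    = ?d * (4 - 2 powr (3 - \<nu>)) + ?d * R"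
    by (simp only: distrib_left)
  moreover have "R \<le> 1"
    using row_one_sum_le[OF \<nu>] by (simp add: R_def)
  ultimately show ?thesis
    using True sum d by (simp add: distrib_right)
next
  case False
  have "(1 + weight_excess \<nu>) * (\<Sum>m = 0..N. p_coeff \<nu> (int i) (int m)) \<le> 0"
    using p_coeff_row_sum[of i N \<nu>] scaled_second_difference_nonpos[OF \<nu>, of i]
      weight_excess_pos[OF \<nu>(1)] i False
    by (intro mult_nonneg_nonpos) auto
  also have "p_coeff \<nu> (int (N - i)) (int N) = 0"
    using i False by (intro p_coeff_superdiagonal(2)) auto
  then have "0 \<le> weight_excess \<nu> * (p_coeff \<nu> (int i) 0 + p_coeff \<nu> (int (N - i)) (int N))"
    using p_coeff_nonneg[OF \<nu>, of 0 "int i"] weight_excess_pos[OF \<nu>(1)] i False by auto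
  finally show ?thesis .
qed

lemma g_coeff_weighted_row_sum:
  assumes \<nu>: "1 < \<nu>" "\<nu> \<le> 2" and N: "1 \<le> N" and "i \<le> N"
  shows "(\<Sum>m = 0..N. g_coeff \<nu> N i m * weight \<nu> N m) \<le> 0"
proof -
  consider "i = 0" | "i = N" | "1 \<le> i" "i < N"
    using \<open>i \<le> N\<close> by linarith
  then show ?thesis
  proof cases
    case 1
    then show ?thesis using g_coeff_weighted_row_sum_0[OF \<nu> N] by simp
  next
    case 2
    have "(\<Sum>m = 0..N. g_coeff \<nu> N N m * weight \<nu> N m)
      = (\<Sum>m = 0..N. g_coeff \<nu> N N (N - m) * weight \<nu> N (N - m))"
      by (subst sum.atLeastAtMost_rev) simp
    also have "\<dots> = (\<Sum>m = 0..N. g_coeff \<nu> N 0 m * weight \<nu> N m)"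
      using g_coeff_mirror[of 0 N] by (intro sum.cong) (auto simp: weight_def)
    finally show ?thesis
      using g_coeff_weighted_row_sum_0[OF \<nu> N] 2 by simp
  next
    case 3
    then have "1 \<le> N - i" "N - i < N" by auto
    with 3 show ?thesis
      using p_coeff_weighted_row_bound[OF \<nu>, of i N] p_coeff_weighted_row_bound[OF \<nu>, of "N - i" N]
      by (simp add: weighted_sum[OF N] g_coeff_row_sum) (simp add: g_coeff_eq_p_coeff algebra_simps)
  qed
qed

lemma weight_ge_1: "1 < \<nu> \<Longrightarrow> 1 \<le> weight \<nu> N i"
  and weight_le: "1 < \<nu> \<Longrightarrow> weight \<nu> N i \<le> 1 + weight_excess \<nu>"
  using weight_excess_pos[of \<nu>] by (auto simp: weight_def)

subsection \<open>Stability\<close>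

text \<open>In the row \<open>j\<close> where \<open>\<bar>v j\<bar> / w j\<close> is largest, the
  off-diagonal terms are dominated by the diagonal one, so this maximum is bounded by the data
  \<open>r j\<close> alone.\<close>

lemma weighted_maximum_principle:
  fixes A :: "nat \<Rightarrow> nat \<Rightarrow> real" and \<omega> r v w :: "nat \<Rightarrow> real"
  assumes w: "\<And>i. i \<le> N \<Longrightarrow> 0 < w i"
    and offdiag: "\<And>i m. i \<le> N \<Longrightarrow> m \<le> N \<Longrightarrow> m \<noteq> i \<Longrightarrow> 0 \<le> A i m"
    and row: "\<And>i. i \<le> N \<Longrightarrow> (\<Sum>m = 0..N. A i m * w m) \<le> 0"
    and \<omega>: "\<And>i. i \<le> N \<Longrightarrow> 0 \<le> \<omega> i"
    and eq: "\<And>i. i \<le> N \<Longrightarrow>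
      (1 - \<omega> i * A i i) * v i - \<omega> i * (\<Sum>m\<in>{0..N} - {i}. A i m * v m) = r i"
    and r: "\<And>i. i \<le> N \<Longrightarrow> \<bar>r i\<bar> \<le> K * w i"
    and "i \<le> N"
  shows "\<bar>v i\<bar> \<le> K * w i"
proof -
  define M where "M = Max ((\<lambda>i. \<bar>v i\<bar> / w i) ` {0..N})"
  have "M \<in> (\<lambda>i. \<bar>v i\<bar> / w i) ` {0..N}"
    unfolding M_def by (intro Max_in) auto
  then obtain j where j: "j \<le> N" "M = \<bar>v j\<bar> / w j" by auto
  have M: "\<bar>v m\<bar> \<le> M * w m" if "m \<le> N" for m
  proof -
    have "\<bar>v m\<bar> / w m \<le> M"
      unfolding M_def using that by (intro Max_ge) auto
    with w[OF that] show ?thesis by (simp add: pos_divide_le_eq)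
  qed
  have vj: "\<bar>v j\<bar> = M * w j"
    using j w[of j] by simp
  let ?S = "\<Sum>m\<in>{0..N} - {j}. A j m * v m" and ?W = "\<Sum>m\<in>{0..N} - {j}. A j m * w m"
  have W: "A j j * w j + ?W \<le> 0"
    using row[OF j(1)] j(1) by (subst (asm) sum.remove[of _ j]) auto
  have "0 \<le> M" using j w[of j] by simp
  have "\<bar>?S\<bar> \<le> (\<Sum>m\<in>{0..N} - {j}. A j m * (M * w m))"
    using offdiag j(1) M by (intro order.trans[OF sum_abs] sum_mono)
      (auto simp: abs_mult intro!: mult_mono)
  also have "\<dots> = M * ?W"
    by (simp add: sum_distrib_left algebra_simps)
  finally have "\<bar>\<omega> j * ?S\<bar> \<le> \<omega> j * (M * ?W)"
    using \<omega>[OF j(1)] by (simp add: abs_mult mult_left_mono)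
  moreover have "(1 - \<omega> j * A j j) * \<bar>v j\<bar> \<le> \<bar>(1 - \<omega> j * A j j) * v j\<bar>"
    by (simp add: abs_mult mult_right_mono)
  ultimately have "(1 - \<omega> j * A j j) * \<bar>v j\<bar> - \<omega> j * (M * ?W) \<le> \<bar>r j\<bar>"
    using eq[OF j(1)] by linarith
  \<comment> \<open>Weighted dominance enters here: adding this to the previous inequality leaves
    \<open>M * w j\<close> alone on the left.\<close>
  moreover have "\<omega> j * M * (A j j * w j + ?W) \<le> 0"
    using \<omega>[OF j(1)] \<open>0 \<le> M\<close> W by (intro mult_nonneg_nonpos) auto
  ultimately have "M * w j \<le> K * w j"
    using r[OF j(1)] by (simp add: vj algebra_simps)
  then have "M \<le> K"
    using w[OF j(1)] by simp
  then show ?thesis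
    using w[OF \<open>i \<le> N\<close>]
    by (intro order.trans[OF M[OF \<open>i \<le> N\<close>] mult_right_mono]) auto
qed

section \<open>Signs of the time coefficients and of \<open>omega\<close>\<close>

lemma l_coeff_0 [simp]: "l_coeff \<gamma> 0 = 1"
  by (simp add: l_coeff_def)

lemma l_coeff_nonneg: "\<gamma> \<le> 1 \<Longrightarrow> 0 \<le> l_coeff \<gamma> s"
  by (auto simp: l_coeff_def intro!: powr_mono2)

text \<open>For \<gamma> < 1 this is concavity of \<open>x powr (1 - \<gamma>)\<close>.\<close>

lemma l_coeff_decreasing:
  assumes "0 < \<gamma>" "\<gamma> \<le> 1"
  shows "l_coeff \<gamma> (s + 1) \<le> l_coeff \<gamma> s"
  using assms second_difference_powr_nonpos[of "1 - \<gamma>" "real s"]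
  by (auto simp: l_coeff_def add.commute)

lemma omega_nonneg:
  assumes "\<gamma> \<le> 1" "1 < \<alpha>" "\<alpha> \<le> 2" "0 \<le> on_mesh xL dx \<tau> c i k"
  shows "0 \<le> omega \<gamma> \<alpha> xL dx \<tau> c i k"
proof -
  have "0 < pi / 2 * (\<alpha> - 1)" "pi / 2 * (\<alpha> - 1) \<le> pi / 2 * 1"
    using assms by (intro mult_pos_pos mult_left_mono; simp)+
  \<comment> \<open>The shift by \<open>pi / 2\<close> moves the angle into the range from 0
    (excluded) to \<open>pi / 2\<close>, where the sine is positive. Hence
    \<open>kappa \<alpha>\<close> is negative and offsets the minus sign in
    \<open>omega\<close>.\<close>
  moreover have "cos (\<alpha> * pi / 2) = - sin (pi / 2 * (\<alpha> - 1))"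
  proof -
    have "\<alpha> * pi / 2 = pi / 2 + pi / 2 * (\<alpha> - 1)"
      by (simp add: field_simps)
    then show ?thesis
      by (simp only: cos_add) simp
  qed
  ultimately have "cos (\<alpha> * pi / 2) < 0"
    using sin_gt_zero[of "pi / 2 * (\<alpha> - 1)"] pi_gt_zero by simp
  then have "kappa \<alpha> \<le> 0"
    by (simp add: kappa_def divide_nonneg_neg)
  then have "kappa \<alpha> * on_mesh xL dx \<tau> c i k \<le> 0"
    using assms by (intro mult_nonpos_nonneg)
  moreover have "0 \<le> Gamma (2 - \<gamma>) * \<tau> powr \<gamma>"
    using assms Gamma_real_pos[of "2 - \<gamma>"] by (intro mult_nonneg_nonneg) auto
  ultimately have "Gamma (2 - \<gamma>) * \<tau> powr \<gamma> * (kappa \<alpha> * on_mesh xL dx \<tau> c i k) \<le> 0"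
    by (rule mult_nonneg_nonpos[rotated])
  then have "0 \<le> - (Gamma (2 - \<gamma>) * \<tau> powr \<gamma> * kappa \<alpha> * on_mesh xL dx \<tau> c i k)"
    by (simp add: mult.assoc)
  moreover have "0 < Gamma (4 - \<alpha>)"
    using assms by (intro Gamma_real_pos) simp
  ultimately show ?thesis
    unfolding omega_def by (intro divide_nonneg_nonneg mult_nonneg_nonneg) auto
qed

text \<open>By linearity the source term cancels, so the error solves the homogeneous
  scheme.\<close>

lemma solves_implicit_scheme_difference:
  assumes u: "solves_implicit_scheme \<gamma> \<alpha> xL xR T c f Nx Nt u"
    and u': "solves_implicit_scheme \<gamma> \<alpha> xL xR T c f Nx Nt u'"
    and "i \<le> Nx" "k < Nt"
  defines "\<omega> \<equiv> omega \<gamma> \<alpha> xL (step (xR - xL) Nx) (step T Nt) c i (k + 1)"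
    and "v \<equiv> \<lambda>i k. u' i k - u i k"
  shows "(1 - \<omega> * g_coeff \<alpha> Nx i i) * v i (k + 1)
      - \<omega> * (\<Sum>m\<in>{0..Nx} - {i}. g_coeff \<alpha> Nx i m * v m (k + 1))
    = (\<Sum>s<k. (l_coeff \<gamma> s - l_coeff \<gamma> (s + 1)) * v i (k - s)) + l_coeff \<gamma> k * v i 0"
proof -
  \<comment> \<open>The first time step fits the general formula: its sum is empty and
    \<open>l_coeff \<gamma> 0 = 1\<close>.\<close>
  have rhs: "(if k = 0 then z i 0 + F 1
      else (\<Sum>s = 0..k - 1. (l_coeff \<gamma> s - l_coeff \<gamma> (s + 1)) * z i (k - s))
        + l_coeff \<gamma> k * z i 0 + F (k + 1))
    = (\<Sum>s<k. (l_coeff \<gamma> s - l_coeff \<gamma> (s + 1)) * z i (k - s)) + l_coeff \<gamma> k * z i 0 + F (k + 1)"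
    for z :: "nat \<Rightarrow> nat \<Rightarrow> real" and F :: "nat \<Rightarrow> real"
  proof (cases k)
    case (Suc k')
    then have "{0..k - 1} = {..<k}" by auto
    with Suc show ?thesis by simp
  qed simp
  define F where "F k = Gamma (2 - \<gamma>) * step T Nt powr \<gamma>
      * on_mesh xL (step (xR - xL) Nx) (step T Nt) f i k" for k
  have scheme: "(1 - \<omega> * g_coeff \<alpha> Nx i i) * z i (k + 1)
      - \<omega> * (\<Sum>m\<in>{0..Nx} - {i}. g_coeff \<alpha> Nx i m * z m (k + 1))
    = (\<Sum>s<k. (l_coeff \<gamma> s - l_coeff \<gamma> (s + 1)) * z i (k - s)) + l_coeff \<gamma> k * z i 0 + F (k + 1)"
    if "solves_implicit_scheme \<gamma> \<alpha> xL xR T c f Nx Nt z" for z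
    using that[unfolded solves_implicit_scheme_def Let_def, rule_format, OF \<open>i \<le> Nx\<close> \<open>k < Nt\<close>]
      rhs[of z F]
    unfolding \<omega>_def F_def by (rule trans)
  show ?thesis
    using scheme[OF u] scheme[OF u']
    by (simp add: v_def right_diff_distrib sum_subtractf)
qed

text \<open>The coefficients are nonnegative, and the differences telescope to
  \<open>1 - l_coeff \<gamma> k\<close>, so the total weight is 1.\<close>

lemma memory_sum_bound:
  fixes e :: "nat \<Rightarrow> real"
  assumes \<gamma>: "0 < \<gamma>" "\<gamma> \<le> 1" and e: "\<And>j. j \<le> k \<Longrightarrow> \<bar>e j\<bar> \<le> K"
  shows "\<bar>(\<Sum>s<k. (l_coeff \<gamma> s - l_coeff \<gamma> (s + 1)) * e (k - s)) + l_coeff \<gamma> k * e 0\<bar> \<le> K"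
proof -
  have "\<bar>\<Sum>s<k. (l_coeff \<gamma> s - l_coeff \<gamma> (s + 1)) * e (k - s)\<bar>
    \<le> (\<Sum>s<k. (l_coeff \<gamma> s - l_coeff \<gamma> (s + 1)) * K)"
    using l_coeff_decreasing[OF \<gamma>] e
    by (intro order.trans[OF sum_abs] sum_mono) (auto simp: abs_mult intro!: mult_mono)
  also have "\<dots> = (1 - l_coeff \<gamma> k) * K"
    using sum_lessThan_telescope'[of "l_coeff \<gamma>" k] by (simp flip: sum_distrib_right)
  finally have "\<bar>\<Sum>s<k. (l_coeff \<gamma> s - l_coeff \<gamma> (s + 1)) * e (k - s)\<bar> \<le> (1 - l_coeff \<gamma> k) * K" .
  moreover have "\<bar>l_coeff \<gamma> k * e 0\<bar> \<le> l_coeff \<gamma> k * K"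
    using l_coeff_nonneg[OF \<gamma>(2)] e by (simp add: abs_mult mult_left_mono)
  ultimately show ?thesis
    by (simp add: left_diff_distrib)
qed

lemma on_mesh_nonneg:
  assumes "xL < xR" "0 < T" "1 \<le> Nx" "1 \<le> Nt" "i \<le> Nx" "k \<le> Nt"
    and c: "\<And>x t. xL \<le> x \<Longrightarrow> x \<le> xR \<Longrightarrow> 0 \<le> t \<Longrightarrow> t \<le> T \<Longrightarrow> 0 \<le> c x t"
  shows "0 \<le> on_mesh xL (step (xR - xL) Nx) (step T Nt) c i k"
proof -
  have fraction: "0 \<le> real j * step L n \<and> real j * step L n \<le> L"
    if "0 < L" "1 \<le> n" "j \<le> n" for L j n
    using that by (auto simp: step_def pos_divide_le_eq mult.commute mult_left_mono)
  show ?thesis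
    unfolding on_mesh_def
    using fraction[of "xR - xL" Nx i] fraction[of T Nt k] assms(1-6) by (intro c) auto
qed

theorem theorem3p3:
  fixes \<gamma> \<alpha> xL xR T :: real
    and c f :: "real \<Rightarrow> real \<Rightarrow> real"
  assumes "0 < \<gamma>" and "\<gamma> \<le> 1"
    and "1 < \<alpha>" and "\<alpha> \<le> 2"
    and "xL < xR" and "0 < T"
    and "\<And>x t. xL \<le> x \<Longrightarrow> x \<le> xR \<Longrightarrow> 0 \<le> t \<Longrightarrow> t \<le> T \<Longrightarrow> 0 \<le> c x t"
  shows "implicit_scheme_unconditionally_stable \<gamma> \<alpha> xL xR T c f"
proof -
  have main: "mesh_norm Nx (\<lambda>i. u' i k - u i k)
      \<le> (1 + weight_excess \<alpha>) * mesh_norm Nx (\<lambda>i. u' i 0 - u i 0)"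
    if N: "1 \<le> Nx" "1 \<le> Nt" and k: "k \<le> Nt"
      and u: "solves_implicit_scheme \<gamma> \<alpha> xL xR T c f Nx Nt u"
      and u': "solves_implicit_scheme \<gamma> \<alpha> xL xR T c f Nx Nt u'"
    for Nx Nt u u' k
  proof -
    define K where "K = mesh_norm Nx (\<lambda>i. u' i 0 - u i 0)"
    have K: "\<bar>u' i 0 - u i 0\<bar> \<le> K" if "i \<le> Nx" for i
      unfolding K_def mesh_norm_def using that by (intro Max_ge) auto
    have "0 \<le> K"
      using K[of 0] by simp
    \<comment> \<open>Strong induction, because the memory term involves all earlier time levels.
      The constant \<open>K\<close> stays the same at every level, so nothing accumulates over the
      time steps.\<close>
    have bound: "\<bar>u' i k - u i k\<bar> \<le> K * weight \<alpha> Nx i" if "i \<le> Nx" "k \<le> Nt" for i k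
      using that
    proof (induction k arbitrary: i rule: less_induct)
      case (less k)
      show ?case
      proof (cases k)
        case 0
        have "K * 1 \<le> K * weight \<alpha> Nx i"
          using \<open>0 \<le> K\<close> weight_ge_1[OF assms(3)] by (intro mult_left_mono)
        with K[OF less.prems(1)] 0 show ?thesis by simp
      next
        case (Suc n)
        let ?\<omega> = "\<lambda>i. omega \<gamma> \<alpha> xL (step (xR - xL) Nx) (step T Nt) c i (n + 1)"
        let ?r = "\<lambda>i. (\<Sum>s<n. (l_coeff \<gamma> s - l_coeff \<gamma> (s + 1)) * (u' i (n - s) - u i (n - s)))
          + l_coeff \<gamma> n * (u' i 0 - u i 0)"
        have n: "n < Nt" using less.prems Suc by simp
        have "\<bar>u' i (n + 1) - u i (n + 1)\<bar> \<le> K * weight \<alpha> Nx i"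
        proof (rule weighted_maximum_principle[where A = "g_coeff \<alpha> Nx" and \<omega> = ?\<omega>
              and v = "\<lambda>i. u' i (n + 1) - u i (n + 1)" and r = ?r])
          show "0 < weight \<alpha> Nx j" for j
            using weight_ge_1[OF assms(3), of Nx j] by simp
          show "0 \<le> g_coeff \<alpha> Nx j m" if "j \<le> Nx" "m \<le> Nx" "m \<noteq> j" for j m
            using g_coeff_off_diagonal_nonneg[OF assms(3,4) that] .
          show "(\<Sum>m = 0..Nx. g_coeff \<alpha> Nx j m * weight \<alpha> Nx m) \<le> 0" if "j \<le> Nx" for j
            using g_coeff_weighted_row_sum[OF assms(3,4) N(1) that] .
          show "0 \<le> ?\<omega> j" if "j \<le> Nx" for j
            using omega_nonneg[OF assms(2-4) on_mesh_nonneg[OF assms(5,6) N that _ assms(7)]] n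
            by simp
          show "(1 - ?\<omega> j * g_coeff \<alpha> Nx j j) * (u' j (n + 1) - u j (n + 1))
            - ?\<omega> j * (\<Sum>m\<in>{0..Nx} - {j}. g_coeff \<alpha> Nx j m * (u' m (n + 1) - u m (n + 1))) = ?r j"
            if "j \<le> Nx" for j
            using solves_implicit_scheme_difference[OF u u' that n] .
          show "\<bar>?r j\<bar> \<le> K * weight \<alpha> Nx j" if "j \<le> Nx" for j
            using less.IH[of _ j] that n Suc
            by (intro memory_sum_bound[OF assms(1,2), where e = "\<lambda>k. u' j k - u j k"]) auto
        qed (use less.prems in auto)
        with Suc show ?thesis by simp
      qed
    qed
    have "\<bar>u' i k - u i k\<bar> \<le> (1 + weight_excess \<alpha>) * K" if "i \<le> Nx" for i
    proof -
      \<comment> \<open>The return to the unweighted norm costs its factor only once, after the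
        induction.\<close>
      have "K * weight \<alpha> Nx i \<le> K * (1 + weight_excess \<alpha>)"
        using \<open>0 \<le> K\<close> weight_le[OF assms(3)] by (intro mult_left_mono)
      with bound[OF that k] show ?thesis by (simp add: mult.commute)
    qed
    then show ?thesis
      unfolding mesh_norm_def[of _ "\<lambda>i. u' i k - u i k"] K_def[symmetric] by (subst Max_le_iff) auto
  qed
  show ?thesis
    unfolding implicit_scheme_unconditionally_stable_def implicit_scheme_stable_under_def
    by (intro exI[of _ "1 + weight_excess \<alpha>"] allI impI main)
qed

end
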